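(* Let $T$ be a regular tetrahedron in $\mathbb{R}^3$, and let $\mathcal{W} := \mathcal{W}(R_T)$ be the peripatetic rotational isometry group determined by the set $R_T$ of six generating rotations $r_E$ around the edges $E$ of $T$, where each $\mathrm{Size}(r_E)$ is the supplement of the dihedral angle of $T$ (that is, $\mathrm{Size}(r_E) = \pi - \theta$, where $\theta$ is the radian measure of the dihedral angle of $T$). Then the orbit $P\mathcal{W} := \{Pf : f \in \mathcal{W}\}$ is dense in $\mathbb{R}^3$ for each $P \in \mathbb{R}^3$.
   Context: Isometries act on the right: $Pf$ is the image of the point $P$ under the isometry $f$, and for a set $M$, $Mf := \{Vf : V \in M\}$. A rotation about a directed line in $\mathbb{R}^3$ has a signed radian measure $\mathrm{Rad}(r) \in (-\pi, \pi]$, taken modulo $2\pi$, which is positive iff the rotation is counterclockwise as viewed looking in the direction of the line; $\mathrm{Size}(r) := |\mathrm{Rad}(r)|$. The axis of $r_E$ is the (directed) line containing the edge $E$. Peripatetic group: let $R = \{r_i : i \in F\}$ be a finite set of rotations, $r_i$ having axis $A_i$ (here $F$ indexes the six edges), and let $\mathcal{G}_i := \{r_i^z : z \in \mathbb{Z}\}$ be the cyclic group generated by $r_i$. For $g_i \in \mathcal{G}_i$ and an isometry $f$ of $\mathbb{R}^3$, let $fg_i$ denote the rotation about the moved axis $A_i f$ (directed by the image under $f$ of the direction of $A_i$) with $\mathrm{Rad}(fg_i) = \mathrm{Rad}(g_i)$. The operation $\star$ is defined recursively by $P(f \star g_i) := (Pf)(fg_i)$ for all points $P$, that is, first apply $f$,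 then apply the rotation $fg_i$; and $\iota \star f = f = f \star \iota$ for the identity isometry $\iota$. The peripatetic group $\mathcal{W}(R)$ is the set of all isometries $g_{j_1} \star g_{j_2} \star \cdots \star g_{j_k}$ (evaluated from left to right, $k$ finite, each $g_{j_t} \in \mathcal{G}_{j_t}$, $j_t \in F$), with operation $\star$. *)

theory Defs
  imports "HOL-Analysis.Analysis"
begin

text \<open>
  Isometries act on the right in the source: its P f is written f P here.
  A directed line is given by a point and a direction vector, which must be nonzero.
\<close>

datatype dline = DLine (base: "real^3") (dir: "real^3")

definition points_of :: "dline \<Rightarrow> (real^3) set" where
  "points_of L = {base L + t *\<^sub>R dir L | t. True}"

text \<open>Direction vectors are transported by the linear part of the isometry.\<close>

definition move_dline :: "(real^3 \<Rightarrow> real^3) \<Rightarrow> dline \<Rightarrow> dline" where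
  "move_dline f L = DLine (f (base L)) (f (base L + dir L) - f (base L))"

text \<open>
  Rodrigues' formula. A positive angle is counterclockwise for a viewer looking in
  the direction of the line, i.e. opposite to the right-hand rule; hence the factor
  w \<times> u instead of u \<times> w in the sine term. The direction vector need not be a unit
  vector, it is normalised here.
\<close>

definition rotation :: "dline \<Rightarrow> real \<Rightarrow> real^3 \<Rightarrow> real^3" where
  "rotation L \<phi> x =
     (let u = sgn (dir L); w = x - base L
      in base L + cos \<phi> *\<^sub>R w + sin \<phi> *\<^sub>R cross3 w u + ((1 - cos \<phi>) * (u \<bullet> w)) *\<^sub>R u)"

definition is_rotation_about :: "dline \<Rightarrow> (real^3 \<Rightarrow> real^3) \<Rightarrow> bool" where
  "is_rotation_about L r \<longleftrightarrow> (\<exists>\<phi>. r = rotation L \<phi>)"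

text \<open>Meaningful when r is a rotation about L and L has nonzero direction vector.\<close>

definition Rad :: "dline \<Rightarrow> (real^3 \<Rightarrow> real^3) \<Rightarrow> real" where
  "Rad L r = (THE t. - pi < t \<and> t \<le> pi \<and> r = rotation L t)"

definition Size :: "dline \<Rightarrow> (real^3 \<Rightarrow> real^3) \<Rightarrow> real" where
  "Size L r = \<bar>Rad L r\<bar>"

definition cyclic_group :: "('a \<Rightarrow> 'a) \<Rightarrow> ('a \<Rightarrow> 'a) set" where
  "cyclic_group r = {if 0 \<le> z then r ^^ nat z else inv r ^^ nat (- z) | z::int. True}"

text \<open>For a rotation g about the axis L, this is the rotation f g about the moved axis.\<close>

definition moved_rotation ::
  "(real^3 \<Rightarrow> real^3) \<Rightarrow> dline \<Rightarrow> (real^3 \<Rightarrow> real^3) \<Rightarrow> real^3 \<Rightarrow> real^3" where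
  "moved_rotation f L g = rotation (move_dline f L) (Rad L g)"

definition star ::
  "(real^3 \<Rightarrow> real^3) \<Rightarrow> dline \<Rightarrow> (real^3 \<Rightarrow> real^3) \<Rightarrow> real^3 \<Rightarrow> real^3" where
  "star f L g P = moved_rotation f L g (f P)"

text \<open>
  The underlying set of the peripatetic group of the rotations r i with axes A i, i in F:
  all values of words evaluated from left to right. The empty word gives the identity.
\<close>

inductive_set peripatetic ::
  "'i set \<Rightarrow> ('i \<Rightarrow> dline) \<Rightarrow> ('i \<Rightarrow> real^3 \<Rightarrow> real^3) \<Rightarrow> (real^3 \<Rightarrow> real^3) set"
  for F :: "'i set" and A :: "'i \<Rightarrow> dline" and r :: "'i \<Rightarrow> real^3 \<Rightarrow> real^3"
where
  peripatetic_id: "id \<in> peripatetic F A r"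
| peripatetic_star: "\<lbrakk>f \<in> peripatetic F A r; i \<in> F; g \<in> cyclic_group (r i)\<rbrakk>
    \<Longrightarrow> star f (A i) g \<in> peripatetic F A r"

definition regular_tetrahedron :: "(real^3) set \<Rightarrow> bool" where
  "regular_tetrahedron T \<longleftrightarrow>
     3 simplex T \<and>
     (\<exists>s. \<forall>x y. x extreme_point_of T \<and> y extreme_point_of T \<and> x \<noteq> y \<longrightarrow> dist x y = s)"

definition vector_angle :: "'a::real_inner \<Rightarrow> 'a \<Rightarrow> real" where
  "vector_angle x y = arccos (x \<bullet> y / (norm x * norm y))"

text \<open>
  The dihedral angle of a convex polyhedron T at an edge E: the plane angle at a point
  P inside E between the perpendiculars to E drawn in the two facets that meet along E.
\<close>

definition dihedral_angle :: "(real^3) set \<Rightarrow> (real^3) set \<Rightarrow> real" where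
  "dihedral_angle T E =
     (THE \<theta>. \<exists>F G P X Y.
        F facet_of T \<and> G facet_of T \<and> F \<noteq> G \<and> E \<subseteq> F \<and> E \<subseteq> G \<and>
        P \<in> rel_interior E \<and> X \<in> F - {P} \<and> Y \<in> G - {P} \<and>
        (\<forall>Q\<in>E. orthogonal (X - P) (Q - P)) \<and> (\<forall>Q\<in>E. orthogonal (Y - P) (Q - P)) \<and>
        \<theta> = vector_angle (X - P) (Y - P))"

end

theory Submission
  imports Defs
begin

text \<open>
  If \<open>f\<close> is a proper rigid motion, then the rotation about the line moved by \<open>f\<close>, applied
  after \<open>f\<close>, is \<open>f\<close> applied after the original rotation. So the product \<open>star\<close> is ordinary
  composition (\<open>star_eq_comp\<close>), and the peripatetic set is the group generated
  by the six rotations, acting on space in the usual way.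

  The dihedral angle of a regular tetrahedron is \<open>arccos (1 / 3)\<close>
  (\<open>dihedral_angle_regular_simplex\<close>), so every generator turns by an angle \<open>\<phi>\<close> with
  \<open>cos \<phi> = - 1 / 3\<close>. Such an angle is not a rational multiple of a full turn
  (\<open>irrational_angle_of_cos\<close>): the numbers \<open>3 ^ n * cos (n * \<phi>)\<close> are integers which,
  for \<open>n \<ge> 1\<close>, are not divisible by 3, so \<open>cos (n * \<phi>)\<close> is never 1. By Kronecker's
  theorem the multiples of \<open>\<phi>\<close> are dense modulo a full turn, and so the closure \<open>C\<close> of an
  orbit is invariant under all rotations about each of the six edge lines, by any angle
  (\<open>orbit_closure_rotation_invariant\<close>).

  It remains to see that a nonempty closed set \<open>C\<close> with this invariance is the whole space
  (\<open>rotation_invariant_closed_set_eq_UNIV\<close>). Given a point \<open>q\<close>, let \<open>c\<close> be a point of \<open>C\<close>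
  nearest to \<open>q\<close>, and put \<open>n = c - q\<close>. Turning \<open>c\<close> about the line through two vertices
  \<open>a\<close> and \<open>b\<close> keeps it in \<open>C\<close>, so the distance to \<open>q\<close> is stationary at \<open>c\<close>, which says
  \<open>n \<bullet> ((a - c) \<times> (b - c)) = 0\<close>. This holds for all pairs of vertices; as the vertices lie
  in no common plane, \<open>n \<times> (a - c)\<close> vanishes for every vertex \<open>a\<close>, and then \<open>n = 0\<close>.
  This step needs no regularity, only that the tetrahedron is not degenerate.
\<close>

unbundle cross3_syntax

section \<open>Rotations about directed lines\<close>

text \<open>
  The linear part of a rotation: the vector \<open>w\<close> turned by the angle \<open>t\<close> about the direction
  \<open>u\<close>, which is meant to be a unit vector. The order \<open>w \<times> u\<close> of the cross product is that
  of \<open>rotation\<close>.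
\<close>

definition rodrigues :: "real^3 \<Rightarrow> real \<Rightarrow> real^3 \<Rightarrow> real^3" where
  "rodrigues u t w = cos t *\<^sub>R w + sin t *\<^sub>R (w \<times> u) + ((1 - cos t) * (u \<bullet> w)) *\<^sub>R u"

lemma rotation_rodrigues:
  "rotation L t x = base L + rodrigues (sgn (dir L)) t (x - base L)"
  by (simp add: rotation_def rodrigues_def Let_def)

lemma linear_rodrigues: "linear (rodrigues u t)"
  by (intro linearI)
     (simp_all add: rodrigues_def cross_add_left cross_mult_left inner_add_right algebra_simps)

lemma rodrigues_add:
  assumes "norm u = 1"
  shows "rodrigues u s (rodrigues u t w) = rodrigues u (s + t) w"
proof -
  have uu: "u \<bullet> u = 1"
    using assms by (simp add: dot_square_norm)
  have cc: "(w \<times> u) \<times> u = (u \<bullet> w) *\<^sub>R u - w"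
    using cross_skew[of "w \<times> u" u] Lagrange[of u w u] uu by simp
  show ?thesis
    by (simp add: rodrigues_def cos_add sin_add cross_add_left Cross3.left_diff_distrib cross_mult_left cc uu
        inner_add_right dot_cross_self algebra_simps)
qed

lemma rodrigues_zero [simp]: "rodrigues u 0 w = w"
  by (simp add: rodrigues_def)

lemma inner_rodrigues: "rodrigues u t v \<bullet> w = v \<bullet> rodrigues u (- t) w"
proof -
  have "(v \<times> u) \<bullet> w = - (v \<bullet> (w \<times> u))"
    by (simp add: cross3_simps)
  then show ?thesis
    by (simp add: rodrigues_def inner_add_left inner_add_right inner_commute algebra_simps)
qed

lemma orthogonal_transformation_rodrigues:
  assumes "norm u = 1"
  shows "orthogonal_transformation (rodrigues u t)"
  by (simp add: orthogonal_transformation_def linear_rodrigues inner_rodrigues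
      rodrigues_add[OF assms])

text \<open>
  An orthogonal map respects cross products up to its determinant. A rotation is the square
  of the rotation by half the angle, so its determinant is 1.
\<close>

lemma rodrigues_cross:
  assumes "norm u = 1"
  shows "rodrigues u t (v \<times> w) = rodrigues u t v \<times> rodrigues u t w"
proof -
  define h where "h = rodrigues u (t / 2)"
  have h: "orthogonal_transformation h"
    unfolding h_def by (rule orthogonal_transformation_rodrigues[OF assms])
  have hh: "rodrigues u t x = h (h x)" for x
    by (simp add: h_def rodrigues_add[OF assms])
  have "\<bar>det (matrix h)\<bar> = 1"
    using h orthogonal_transformation_det by blast
  then have "det (matrix h) * det (matrix h) = 1"
    by (metis abs_mult_self_eq mult_1)
  then show ?thesis
    using h by (simp add: hh cross_orthogonal_transformation[OF h]
        linear_cmul[OF orthogonal_transformation_linear[OF h]])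
qed

lemma rotation_add:
  assumes "dir L \<noteq> 0"
  shows "rotation L s (rotation L t x) = rotation L (s + t) x"
  using assms by (simp add: rotation_rodrigues rodrigues_add norm_sgn)

lemma rotation_zero [simp]: "rotation L 0 = id"
  by (simp add: rotation_rodrigues fun_eq_iff)

lemma rotation_funpow:
  assumes "dir L \<noteq> 0"
  shows "(rotation L t) ^^ n = rotation L (real n * t)"
  by (induction n) (simp_all add: fun_eq_iff rotation_add[OF assms] algebra_simps)

lemma inv_rotation:
  assumes "dir L \<noteq> 0"
  shows "inv (rotation L t) = rotation L (- t)"
  by (rule inv_unique_comp) (simp_all add: fun_eq_iff rotation_add[OF assms])

lemma cyclic_group_rotation:
  assumes "dir L \<noteq> 0"
  shows "cyclic_group (rotation L t) = {rotation L (of_int z * t) | z. True}"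
proof -
  have "(if 0 \<le> z then rotation L t ^^ nat z else inv (rotation L t) ^^ nat (- z)) =
      rotation L (of_int z * t)" for z :: int
    by (simp add: inv_rotation[OF assms] rotation_funpow[OF assms])
  then show ?thesis
    by (simp add: cyclic_group_def)
qed

lemma continuous_on_rotation: "continuous_on A (rotation L t)"
proof -
  have "rotation L t = (\<lambda>x. base L + rodrigues (sgn (dir L)) t (x - base L))"
    by (simp add: fun_eq_iff rotation_rodrigues)
  then show ?thesis
    by (auto intro!: continuous_intros linear_continuous_on_compose[OF _ linear_rodrigues])
qed

lemma continuous_rotation_angle: "isCont (\<lambda>t. rotation L t x) a"
  unfolding rotation_def Let_def by (intro continuous_intros)

lemma rotation_cos_sin_cong:
  "cos s = cos t \<Longrightarrow> sin s = sin t \<Longrightarrow> rotation L s = rotation L t"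
  by (simp add: fun_eq_iff rotation_def)

lemma rotation_eq_imp_cos_sin_eq:
  assumes "dir L \<noteq> 0" "rotation L s = rotation L t"
  shows "cos s = cos t" "sin s = sin t"
proof -
  define u where "u = sgn (dir L)"
  have "norm u = 1"
    using assms by (simp add: u_def norm_sgn)
  obtain w where w: "w \<noteq> 0" "orthogonal u w"
    using orthogonal_to_vector_exists[of u] by auto
  then have uw: "u \<bullet> w = 0" by (simp add: orthogonal_def)
  have "rotation L s (base L + w) = rotation L t (base L + w)"
    using assms by simp
  then have eq: "cos s *\<^sub>R w + sin s *\<^sub>R (w \<times> u) = cos t *\<^sub>R w + sin t *\<^sub>R (w \<times> u)"
    by (simp add: rotation_rodrigues rodrigues_def flip: u_def) (simp add: uw)
  have nz: "w \<times> u \<noteq> 0"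
    using norm_and_cross_eq_0[of w u] uw w \<open>norm u = 1\<close> by (auto simp: inner_commute)
  from eq have "(cos s - cos t) * (w \<bullet> w) = 0"
    by (auto dest!: arg_cong[where f="\<lambda>v. v \<bullet> w"] simp: inner_add_left dot_cross_self algebra_simps)
  then show "cos s = cos t" using w by simp
  from eq this nz show "sin s = sin t" by simp
qed

text \<open>
  Modulo a full turn, the angle is determined by the rotation once the axis has a nonzero
  direction, so the description in the definition of \<open>Rad\<close> is proper.
\<close>

lemma Rad_rotation:
  assumes "dir L \<noteq> 0"
  shows "rotation L (Rad L (rotation L t)) = rotation L t"
proof -
  obtain y where y: "- pi < y" "y \<le> pi" "sin y = sin t" "cos y = cos t"
    using sincos_principal_value by blast
  have "\<exists>!y. - pi < y \<and> y \<le> pi \<and> rotation L t = rotation L y"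
  proof (rule ex1I[of _ y])
    show "- pi < y \<and> y \<le> pi \<and> rotation L t = rotation L y"
      using y by (metis rotation_cos_sin_cong)
    fix z assume z: "- pi < z \<and> z \<le> pi \<and> rotation L t = rotation L z"
    then have "cos z = cos y" "sin z = sin y"
      using rotation_eq_imp_cos_sin_eq[OF assms] y by metis+
    then obtain n :: int where n: "z = y + 2 * pi * n"
      using sin_cos_eq_iff by blast
    then have "2 * pi * of_int n < 2 * pi * 1" "2 * pi * (-1) < 2 * pi * of_int n"
      using y z by linarith+
    then have "of_int n < (1::real)" "(-1::real) < of_int n"
      using mult_less_cancel_left_pos[of "2 * pi" "of_int n" 1]
        mult_less_cancel_left_pos[of "2 * pi" "- 1" "of_int n"] by auto
    then have "n = 0" by linarith
    then show "z = y" using n by simp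
  qed
  from theI'[OF this] show ?thesis
    unfolding Rad_def by auto
qed

section \<open>The peripatetic product as composition\<close>

text \<open>
  Orientation-preserving isometries of space. That the linear part \<open>g\<close> has determinant 1 is
  expressed by its compatibility with the cross product, which is the form in which it is used.
\<close>

definition rigid_motion :: "(real^3 \<Rightarrow> real^3) \<Rightarrow> bool" where
  "rigid_motion f \<longleftrightarrow> (\<exists>b g. orthogonal_transformation g \<and>
     (\<forall>x y. g (x \<times> y) = g x \<times> g y) \<and> f = (\<lambda>x. b + g x))"

lemma rigid_motion_id: "rigid_motion id"
  unfolding rigid_motion_def
  by (intro exI[of _ 0] exI[of _ id]) (auto simp: orthogonal_transformation_def linear_id fun_eq_iff)

lemma rigid_motion_compose_rotation:
  assumes "rigid_motion f" "dir L \<noteq> 0"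
  shows "rigid_motion (f \<circ> rotation L t)"
proof -
  obtain b g where g: "orthogonal_transformation g" "\<And>x y. g (x \<times> y) = g x \<times> g y"
    and f: "f = (\<lambda>x. b + g x)"
    using assms unfolding rigid_motion_def by blast
  define h where "h = rodrigues (sgn (dir L)) t"
  have u: "norm (sgn (dir L)) = 1"
    using assms by (simp add: norm_sgn)
  have h: "orthogonal_transformation h" "\<And>x y. h (x \<times> y) = h x \<times> h y"
    unfolding h_def by (simp_all add: orthogonal_transformation_rodrigues rodrigues_cross u)
  note lin = orthogonal_transformation_linear[OF g(1)] orthogonal_transformation_linear[OF h(1)]
  have "f \<circ> rotation L t = (\<lambda>x. (b + g (base L - h (base L))) + (g \<circ> h) x)"
    by (auto simp: fun_eq_iff f rotation_rodrigues linear_add[OF lin(1)] linear_diff[OF lin(1)]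
        linear_diff[OF lin(2)] simp flip: h_def)
  moreover have "orthogonal_transformation (g \<circ> h)"
    using g h by (simp add: orthogonal_transformation_compose)
  ultimately show ?thesis
    unfolding rigid_motion_def using g h
    by (intro exI[of _ "b + g (base L - h (base L))"] exI[of _ "g \<circ> h"]) auto
qed

text \<open>
  Conjugating a rotation by a rigid motion gives the rotation by the same angle about the moved
  axis. The sign of the angle is preserved because the motion respects cross products.
\<close>

lemma rotation_move_dline:
  assumes "rigid_motion f"
  shows "rotation (move_dline f L) t (f x) = f (rotation L t x)"
proof -
  obtain b g where g: "orthogonal_transformation g" "\<And>x y. g (x \<times> y) = g x \<times> g y"
    and f: "f = (\<lambda>x. b + g x)"
    using assms unfolding rigid_motion_def by blast
  note lin = orthogonal_transformation_linear[OF g(1)]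
  have u: "sgn (g (dir L)) = g (sgn (dir L))"
    by (simp add: sgn_div_norm linear_cmul[OF lin] orthogonal_transformation_norm[OF g(1)])
  have "g v \<bullet> g w = v \<bullet> w" for v w
    using g by (simp add: orthogonal_transformation_def)
  then have "rodrigues (g v) t (g w) = g (rodrigues v t w)" for v w
    by (simp add: rodrigues_def linear_add[OF lin] linear_cmul[OF lin] g)
  then show ?thesis
    by (simp add: rotation_rodrigues move_dline_def f linear_add[OF lin] u
        flip: linear_diff[OF lin])
qed

lemma star_eq_comp:
  assumes "rigid_motion f" "dir L \<noteq> 0"
  shows "star f L (rotation L t) = f \<circ> rotation L t"
  by (simp add: fun_eq_iff star_def moved_rotation_def rotation_move_dline assms Rad_rotation)

text \<open>
  Rotations \<open>r i\<close> about axes \<open>A i\<close> with nonzero direction, by given angles \<open>\<phi> i\<close>, as generators of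
  a peripatetic group.
\<close>

context
  fixes F :: "'i set" and A :: "'i \<Rightarrow> dline" and \<phi> :: "'i \<Rightarrow> real"
    and r :: "'i \<Rightarrow> real^3 \<Rightarrow> real^3"
  assumes dir: "\<And>i. i \<in> F \<Longrightarrow> dir (A i) \<noteq> 0"
    and r: "\<And>i. i \<in> F \<Longrightarrow> r i = rotation (A i) (\<phi> i)"
begin

lemma peripatetic_rigid_motion: "f \<in> peripatetic F A r \<Longrightarrow> rigid_motion f"
proof (induction rule: peripatetic.induct)
  case peripatetic_id
  show ?case by (rule rigid_motion_id)
next
  case (peripatetic_star f i g)
  then obtain t where "g = rotation (A i) t"
    using cyclic_group_rotation[OF dir] r by auto
  then show ?case
    using peripatetic_star dir
    by (simp add: star_eq_comp rigid_motion_compose_rotation del: comp_apply)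
qed

text \<open>
  Words are built by composing with generators on the right, but moving the points of an orbit
  requires composition on the left. Both are possible since \<open>star\<close> is composition.
\<close>

lemma peripatetic_left_mult:
  assumes "i \<in> F" "f \<in> peripatetic F A r"
  shows "rotation (A i) (of_int z * \<phi> i) \<circ> f \<in> peripatetic F A r"
  using assms(2)
proof (induction rule: peripatetic.induct)
  have g: "rotation (A i) (of_int z * \<phi> i) \<in> cyclic_group (r i)"
    using assms(1) cyclic_group_rotation[OF dir] r by auto
  case peripatetic_id
  show ?case
    using peripatetic.peripatetic_star[OF peripatetic.peripatetic_id[of F A r] assms(1) g]
    by (simp add: star_eq_comp rigid_motion_id dir assms(1))
next
  case (peripatetic_star f j g)
  then obtain t where g: "g = rotation (A j) t"
    using cyclic_group_rotation[OF dir] r by auto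
  have "star (rotation (A i) (of_int z * \<phi> i) \<circ> f) (A j) g =
      rotation (A i) (of_int z * \<phi> i) \<circ> star f (A j) g"
    using peripatetic_rigid_motion[OF peripatetic_star.IH]
      peripatetic_rigid_motion[OF peripatetic_star.hyps(1)] dir[OF peripatetic_star.hyps(2)]
    by (simp add: g star_eq_comp comp_assoc del: comp_apply)
  then show ?case
    using peripatetic.peripatetic_star[OF peripatetic_star.IH peripatetic_star.hyps(2,3)]
    by (simp del: comp_apply)
qed

lemma orbit_closure_rotation_invariant:
  assumes i: "i \<in> F" and irr: "\<phi> i / (2 * pi) \<notin> \<rat>"
    and x: "x \<in> closure {f P | f. f \<in> peripatetic F A r}" (is "_ \<in> closure ?O")
  shows "rotation (A i) t x \<in> closure ?O"
proof -
  have inv: "rotation (A i) (of_int z * \<phi> i) x \<in> closure ?O" for z :: int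
  proof -
    have "rotation (A i) (of_int z * \<phi> i) ` ?O \<subseteq> closure ?O"
      using peripatetic_left_mult[OF i] closure_subset[of ?O] by fastforce
    then show ?thesis
      using image_closure_subset[OF continuous_on_rotation closed_closure] x by blast
  qed
  have "\<exists>y\<in>closure ?O. dist y (rotation (A i) t x) < e" if "e > 0" for e
  proof -
    obtain d where d: "d > 0"
      "\<And>s. \<bar>s - t\<bar> < d \<Longrightarrow> dist (rotation (A i) s x) (rotation (A i) t x) < e"
      using continuous_rotation_angle[of t "A i" x] \<open>e > 0\<close>
      by (auto simp: continuous_at_eps_delta dist_real_def)
    \<comment> \<open>Kronecker's theorem: some multiple of the angle is close to \<open>t\<close> modulo a full turn.\<close>
    obtain h k where hk: "\<bar>of_int k * (\<phi> i / (2 * pi)) - of_int h - t / (2 * pi)\<bar> < d / (2 * pi)"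
      by (rule sequence_of_fractional_parts_is_dense[OF irr, of "d / (2 * pi)" "t / (2 * pi)"])
         (use d(1) that in auto)
    define s where "s = of_int k * \<phi> i - 2 * pi * of_int h"
    have "of_int k * (\<phi> i / (2 * pi)) - of_int h - t / (2 * pi) = (s - t) / (2 * pi)"
      by (simp add: s_def field_simps)
    then have "\<bar>s - t\<bar> / (2 * pi) < d / (2 * pi)"
      using hk by (simp only: abs_divide) simp
    then have "\<bar>s - t\<bar> < d"
      by (simp add: divide_less_cancel)
    moreover have "rotation (A i) s = rotation (A i) (of_int k * \<phi> i)"
      using sin_cos_eq_iff[of "of_int k * \<phi> i" s]
      by (intro rotation_cos_sin_cong) (auto simp: s_def algebra_simps)
    ultimately show ?thesis
      using d(2)[of s] inv[of k] by auto
  qed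
  then show ?thesis
    using closure_approachable[of "rotation (A i) t x" "closure ?O"] by simp
qed

end

section \<open>Angles incommensurable with a full turn\<close>

lemma irrational_angle_of_cos:
  assumes "cos \<phi> = - 1 / 3"
  shows "\<phi> / (2 * pi) \<notin> \<rat>"
proof
  \<comment> \<open>The recursion \<open>cos ((n + 2) * \<phi>) = 2 * cos \<phi> * cos ((n + 1) * \<phi>) - cos (n * \<phi>)\<close>, cleared of
    denominators. Two consecutive terms are carried along; the residue modulo 3 is fixed only
    for positive multiples of the angle.\<close>
  have num: "\<exists>k m :: int. 3 ^ n * cos (real n * \<phi>) = of_int k \<and>
      3 ^ Suc n * cos (real (Suc n) * \<phi>) = of_int (3 * m - 1)" for n
  proof (induction n)
    case 0
    have "3 ^ 0 * cos (real 0 * \<phi>) = of_int 1"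
      "3 ^ Suc 0 * cos (real (Suc 0) * \<phi>) = of_int (3 * 0 - 1)"
      using assms by simp_all
    then show ?case by blast
  next
    case (Suc n)
    then obtain k m :: int where k: "3 ^ n * cos (real n * \<phi>) = of_int k"
      and m: "3 ^ Suc n * cos (real (Suc n) * \<phi>) = of_int (3 * m - 1)"
      by blast
    have "cos (real (Suc (Suc n)) * \<phi>) + cos (real n * \<phi>) = 2 * cos (real (Suc n) * \<phi>) * cos \<phi>"
      using cos_add[of "real (Suc n) * \<phi>" \<phi>] cos_diff[of "real (Suc n) * \<phi>" \<phi>]
      by (simp add: algebra_simps)
    then have rec: "cos (real (Suc (Suc n)) * \<phi>) =
        - 2 / 3 * cos (real (Suc n) * \<phi>) - cos (real n * \<phi>)"
      using assms by simp
    have "3 ^ Suc (Suc n) * cos (real (Suc (Suc n)) * \<phi>) =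
        - 2 * (3 ^ Suc n * cos (real (Suc n) * \<phi>)) - 9 * (3 ^ n * cos (real n * \<phi>))"
      unfolding rec by (simp add: algebra_simps)
    also have "\<dots> = of_int (3 * (- 2 * m + 1 - 3 * k) - 1)"
      unfolding k m by simp
    finally show ?case using m by blast
  qed
  assume "\<phi> / (2 * pi) \<in> \<rat>"
  then obtain h k :: int where k: "k > 0" and hk: "\<phi> / (2 * pi) = of_int h / of_int k"
    by (meson Rats_cases')
  obtain n where n: "k = int (Suc n)"
    using k by (metis zero_less_imp_eq_int gr0_implies_Suc)
  have "real (Suc n) * \<phi> = 2 * pi * of_int h"
    using hk k unfolding n by (simp add: field_simps)
  then have "cos (real (Suc n) * \<phi>) = 1"
    by (simp only: cos_int_2pin)
  with num[of n] obtain m :: int where "3 ^ Suc n = (of_int (3 * m - 1) :: real)"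
    by auto
  then have "3 * 3 ^ n = 3 * m - (1 :: int)"
    by (simp flip: of_int_eq_iff[where ?'a = real])
  then show False by presburger
qed

section \<open>Sets invariant under the rotations about the edges of a simplex\<close>

lemma zero_of_constant_inner_on_affine_basis:
  fixes v :: "real^3"
  assumes "\<not> affine_dependent S" "card S = 4" "\<And>x. x \<in> S \<Longrightarrow> v \<bullet> x = k"
  shows "v = 0"
proof (rule ccontr)
  assume "v \<noteq> 0"
  have "S \<subseteq> {x. v \<bullet> x = k}"
    using assms by auto
  then have "aff_dim S \<le> 2"
    using aff_dim_subset[of S "{x. v \<bullet> x = k}"] \<open>v \<noteq> 0\<close> by simp
  then show False
    using aff_dim_affine_independent[OF assms(1)] assms(2) by simp
qed

text \<open>
  The first-order condition for a minimum, at angle 0, of the distance from \<open>q\<close> to the point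
  \<open>c\<close> as it turns about the line \<open>L\<close>.
\<close>

lemma closest_point_orthogonal_to_rotation:
  assumes "\<And>t. dist q c \<le> dist q (rotation L t c)"
  shows "(c - q) \<bullet> ((base L - c) \<times> dir L) = 0"
proof -
  define u where "u = sgn (dir L)"
  define w where "w = c - base L"
  define p where "p = base L - q"
  define f where "f t = (norm (p + cos t *\<^sub>R w + sin t *\<^sub>R (w \<times> u) + ((1 - cos t) * (u \<bullet> w)) *\<^sub>R u))\<^sup>2" for t
  have rot: "f t = (dist q (rotation L t c))\<^sup>2" for t
    by (simp add: f_def rotation_def dist_norm Let_def p_def norm_minus_commute[of q] flip: w_def u_def)
       (simp add: algebra_simps)
  have "(f has_real_derivative 2 * ((p + w) \<bullet> (w \<times> u))) (at 0)"
    unfolding f_def power2_norm_eq_inner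
    by (auto intro!: derivative_eq_intros simp: has_field_derivative_def inner_commute)
  moreover have "f 0 \<le> f t" for t
    using assms[of t] by (simp add: rot)
  ultimately have "2 * ((p + w) \<bullet> (w \<times> u)) = 0"
    by (intro DERIV_local_min[of f _ 0 1]) auto
  then have "(c - q) \<bullet> ((base L - c) \<times> u) = 0"
    by (simp add: p_def w_def Cross3.left_diff_distrib inner_diff_right)
  then show ?thesis
    by (auto simp: u_def sgn_div_norm cross_mult_right)
qed

lemma rotation_invariant_closed_set_eq_UNIV:
  fixes C :: "(real^3) set"
  assumes S: "\<not> affine_dependent S" "card S = 4"
    and C: "closed C" "C \<noteq> {}"
    and inv: "\<And>a b. \<lbrakk>a \<in> S; b \<in> S; a \<noteq> b\<rbrakk> \<Longrightarrow>
      \<exists>L. {a, b} \<subseteq> points_of L \<and> (\<forall>t. \<forall>x\<in>C. rotation L t x \<in> C)"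
  shows "C = UNIV"
proof -
  have "q \<in> C" for q
  proof -
    obtain c where c: "c \<in> C" "\<And>y. y \<in> C \<Longrightarrow> dist q c \<le> dist q y"
      by (rule distance_attains_inf[OF C, of q]) (rule that)
    define n where "n = c - q"
    have triple: "(n \<times> (a - c)) \<bullet> (b - c) = 0" if ab: "a \<in> S" "b \<in> S" for a b
    proof (cases "a = b")
      case False
      from inv[OF ab False] obtain L where L: "{a, b} \<subseteq> points_of L" "\<And>t. rotation L t c \<in> C"
        using c(1) by auto
      then obtain s t where st: "a = base L + s *\<^sub>R dir L" "b = base L + t *\<^sub>R dir L"
        unfolding points_of_def by auto
      define p where "p = base L - c"
      have "(n \<times> (a - c)) \<bullet> (b - c) = n \<bullet> ((a - c) \<times> (b - c))"
        by (metis cross_triple inner_commute)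
      also have "(a - c) \<times> (b - c) = (p + s *\<^sub>R dir L) \<times> (p + t *\<^sub>R dir L)"
        by (simp add: st p_def algebra_simps)
      also have "\<dots> = (t - s) *\<^sub>R (p \<times> dir L)"
        using cross_skew[of "dir L" p]
        by (simp add: cross_add_left cross_add_right cross_mult_left cross_mult_right algebra_simps)
      also have "n \<bullet> \<dots> = (t - s) * (n \<bullet> ((base L - c) \<times> dir L))"
        by (simp add: p_def)
      also have "\<dots> = 0"
        using closest_point_orthogonal_to_rotation[of q c L] c(2) L(2) by (simp add: n_def)
      finally show ?thesis .
    qed (simp add: dot_cross_self)
    have "n \<times> (a - c) = 0" if "a \<in> S" for a
      using zero_of_constant_inner_on_affine_basis[OF S, of "n \<times> (a - c)" "(n \<times> (a - c)) \<bullet> c"]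
        triple[OF that] by (simp add: inner_diff_right)
    \<comment> \<open>By the triple product identity every \<open>x \<times> n\<close> has the same inner product with all vertices.\<close>
    then have "(x \<times> n) \<bullet> (a - c) = 0" if "a \<in> S" for a x
      using that by (metis cross_triple inner_commute inner_zero_right)
    then have "x \<times> n = 0" for x
      using zero_of_constant_inner_on_affine_basis[OF S, of "x \<times> n" "(x \<times> n) \<bullet> c"]
      by (simp add: inner_diff_right)
    then have "n = 0"
      by (metis cross_basis_nonzero cross_skew neg_equal_0_iff_equal)
    then show ?thesis
      using c by (simp add: n_def)
  qed
  then show ?thesis by auto
qed

section \<open>The dihedral angle of the regular tetrahedron\<close>

lemma altitude_orthogonal:
  fixes a b c :: "'a::real_inner"
  assumes "dist a c = dist b c"
  shows "(c - midpoint a b) \<bullet> (b - a) = 0"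
proof -
  have "(norm (a - c))\<^sup>2 = (norm (b - c))\<^sup>2"
    using assms by (simp add: dist_norm)
  then show ?thesis
    by (simp add: power2_norm_eq_inner midpoint_def inner_diff_left inner_diff_right
        inner_add_left inner_commute algebra_simps)
qed

text \<open>
  In an isosceles triangle with base \<open>a b\<close>, a perpendicular drawn to the base inside the triangle,
  from any point of the base, has the direction of the altitude towards the apex.
  So the angle in the definition of the dihedral angle does not depend on the choice of the points.
\<close>

lemma triangle_altitude_direction:
  fixes a b c :: "'a::real_inner"
  assumes ac: "dist a c = dist b c" and "a \<noteq> b"
    and X: "X \<in> convex hull {a, b, c}" "X \<noteq> P" and P: "P \<in> closed_segment a b"
    and orth: "orthogonal (X - P) (a - P)" "orthogonal (X - P) (b - P)"
  shows "\<exists>l>0. X - P = l *\<^sub>R (c - midpoint a b)"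
proof -
  obtain u v w where uvw: "0 \<le> u" "0 \<le> v" "0 \<le> w" "u + v + w = 1"
    and Xeq: "X = u *\<^sub>R a + v *\<^sub>R b + w *\<^sub>R c"
    using X(1) unfolding convex_hull_3 by blast
  obtain t where Peq: "P = (1 - t) *\<^sub>R a + t *\<^sub>R b"
    using P unfolding closed_segment_def by blast
  define g where "g = v - t + w / 2"
  have u: "u = 1 - v - w" using uvw by simp
  have XP: "X - P = w *\<^sub>R (c - midpoint a b) + g *\<^sub>R (b - a)"
    by (rule vector_eq_ldot[THEN iffD1])
       (simp add: Xeq Peq g_def midpoint_def u inner_add_right inner_diff_right field_simps)
  have "(c - midpoint a b) \<bullet> (b - a) = 0"
    using ac by (rule altitude_orthogonal)
  moreover have "(X - P) \<bullet> (b - a) = 0"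
  proof -
    have "b - a = (b - P) - (a - P)" by simp
    then show ?thesis
      using orth by (metis inner_diff_right orthogonal_def diff_zero)
  qed
  ultimately have "g * ((b - a) \<bullet> (b - a)) = 0"
    unfolding XP by (simp add: inner_add_left)
  then have "g = 0" using \<open>a \<noteq> b\<close> by simp
  with XP X(2) have "w \<noteq> 0" by auto
  with uvw XP \<open>g = 0\<close> show ?thesis by (intro exI[of _ w]) auto
qed

lemma vector_angle_scaleR:
  assumes "l > 0" "m > 0"
  shows "vector_angle (l *\<^sub>R x) (m *\<^sub>R y) = vector_angle x y"
  using assms by (simp add: vector_angle_def)

lemma vector_angle_commute: "vector_angle x y = vector_angle y x"
  by (simp add: vector_angle_def inner_commute mult.commute)

text \<open>
  The altitudes of two adjacent faces onto their common edge each have squared length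
  \<open>3 / 4 * s\<^sup>2\<close>, and their inner product is \<open>s\<^sup>2 / 4\<close>.
\<close>

lemma vector_angle_altitudes:
  fixes a b c d :: "'a::real_inner"
  assumes "a \<noteq> b" and "dist a b = s" "dist a c = s" "dist a d = s" "dist b c = s" "dist b d = s" "dist c d = s"
  shows "vector_angle (c - midpoint a b) (d - midpoint a b) = arccos (1 / 3)"
proof -
  define x y z where "x = b - a" and "y = c - a" and "z = d - a"
  have "s > 0" using assms(1,2) by auto
  have dists: "x \<bullet> x = s\<^sup>2" "y \<bullet> y = s\<^sup>2" "z \<bullet> z = s\<^sup>2" "(x - y) \<bullet> (x - y) = s\<^sup>2"
    "(x - z) \<bullet> (x - z) = s\<^sup>2" "(y - z) \<bullet> (y - z) = s\<^sup>2"
    using assms(2-) by (auto simp: x_def y_def z_def dist_norm norm_minus_commute simp flip: power2_norm_eq_inner)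
  then have inn: "x \<bullet> y = s\<^sup>2 / 2" "x \<bullet> z = s\<^sup>2 / 2" "y \<bullet> z = s\<^sup>2 / 2"
    by (simp_all add: inner_diff_left inner_diff_right inner_commute)
  have "w - midpoint a b = (w - a) - (1 / 2) *\<^sub>R x" for w
    by (rule vector_eq_ldot[THEN iffD1])
       (simp add: x_def midpoint_def inner_add_right inner_diff_right field_simps)
  then have c: "c - midpoint a b = y - (1 / 2) *\<^sub>R x" and d: "d - midpoint a b = z - (1 / 2) *\<^sub>R x"
    by (simp_all only: y_def z_def)
  have "(c - midpoint a b) \<bullet> (d - midpoint a b) = s\<^sup>2 / 4"
    unfolding c d using dists(1-3) inn by (simp add: inner_diff_left inner_diff_right inner_commute)
  moreover have "(norm (c - midpoint a b))\<^sup>2 = 3 / 4 * s\<^sup>2" "(norm (d - midpoint a b))\<^sup>2 = 3 / 4 * s\<^sup>2"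
    unfolding c d power2_norm_eq_inner
    using dists(1-3) inn by (simp_all add: inner_diff_left inner_diff_right inner_commute)
  then have "norm (c - midpoint a b) * norm (d - midpoint a b) = 3 / 4 * s\<^sup>2"
    by (metis norm_ge_zero power2_eq_imp_eq power2_eq_square)
  ultimately show ?thesis
    unfolding vector_angle_def by (simp only:) (use \<open>s > 0\<close> in simp)
qed

lemma convex_hull_subset_affine_independent:
  assumes "\<not> affine_dependent S" "e \<subseteq> S" "f \<subseteq> S" "convex hull e \<subseteq> convex hull f"
  shows "e \<subseteq> f"
proof
  fix x assume x: "x \<in> e"
  show "x \<in> f"
  proof (rule ccontr)
    assume "x \<notin> f"
    then have "f \<subseteq> S - {x}" using assms by auto
    moreover have "x \<in> convex hull f"
      using x assms(4) hull_subset[of e convex] by auto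
    ultimately have "x \<in> affine hull (S - {x})"
      using convex_hull_subset_affine_hull hull_mono by blast
    then show False
      using assms x unfolding affine_dependent_def by blast
  qed
qed

lemma dihedral_angle_regular_simplex:
  fixes S :: "(real^3) set"
  assumes S: "\<not> affine_dependent S" "card S = 4"
    and s: "\<And>x y. \<lbrakk>x \<in> S; y \<in> S; x \<noteq> y\<rbrakk> \<Longrightarrow> dist x y = s"
    and ab: "a \<in> S" "b \<in> S" "a \<noteq> b"
  shows "dihedral_angle (convex hull S) (convex hull {a, b}) = arccos (1 / 3)"
proof -
  have "finite S" using S by (metis card.infinite zero_neq_numeral)
  have "card (S - {a, b}) = 2"
    using S ab \<open>finite S\<close> by (simp add: card_Diff_subset)
  then obtain c d where cd: "S - {a, b} = {c, d}" "c \<noteq> d"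
    by (meson card_2_iff)
  then have Seq: "S = {a, b, c, d}" and ne: "c \<noteq> a" "c \<noteq> b" "d \<noteq> a" "d \<noteq> b"
    using ab by blast+
  then have inS: "c \<in> S" "d \<in> S" and Sdel: "S - {c} = {a, b, d}" "S - {d} = {a, b, c}"
    using cd(2) by auto
  have facet: "F facet_of convex hull S \<longleftrightarrow> (\<exists>u\<in>S. F = convex hull (S - {u}))" for F
    using facet_of_convex_hull_affine_independent_alt[OF S(1)] S(2) by auto
  have facets: "F = convex hull {a, b, c} \<or> F = convex hull {a, b, d}"
    if F: "F facet_of convex hull S" "convex hull {a, b} \<subseteq> F" for F
  proof -
    obtain u where u: "u \<in> S" "F = convex hull (S - {u})"
      using iffD1[OF facet F(1)] by blast
    have "{a, b} \<subseteq> S - {u}"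
      using convex_hull_subset_affine_independent[OF S(1), of "{a, b}" "S - {u}"] ab F(2) u(2)
      by auto
    with u(1) Seq have "u = c \<or> u = d" by blast
    with u(2) Sdel show ?thesis by metis
  qed
  have dists: "dist a b = s" "dist a c = s" "dist a d = s" "dist b c = s" "dist b d = s" "dist c d = s"
    using s[OF ab] s[OF ab(1) inS(1)] s[OF ab(1) inS(2)] s[OF ab(2) inS(1)] s[OF ab(2) inS(2)]
      s[OF inS cd(2)] ne by auto
  have angle: "vector_angle (c - midpoint a b) (d - midpoint a b) = arccos (1 / 3)"
    by (rule vector_angle_altitudes[OF ab(3) dists])
  have seg: "convex hull {a, b} = closed_segment a b"
    by (simp add: segment_convex_hull)
  show ?thesis
    unfolding dihedral_angle_def
  proof (rule the_equality)
    let ?m = "midpoint a b"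
    have fac: "convex hull {a, b, c} facet_of convex hull S"
      "convex hull {a, b, d} facet_of convex hull S"
      using facet inS Sdel by metis+
    have neq: "convex hull {a, b, c} \<noteq> convex hull {a, b, d}"
    proof
      assume "convex hull {a, b, c} = convex hull {a, b, d}"
      then have "{a, b, c} \<subseteq> {a, b, d}"
        using convex_hull_subset_affine_independent[OF S(1), of "{a, b, c}" "{a, b, d}"] ab(1,2) inS
        by simp
      then show False using ne cd(2) by simp
    qed
    have m: "?m \<in> rel_interior (convex hull {a, b})"
      using ab(3) by (simp add: seg rel_interior_closed_segment)
    have noteq: "x \<noteq> ?m" if "x \<in> S" "x \<noteq> a" "x \<noteq> b" for x
    proof
      assume "x = ?m"
      then have "convex hull {x} \<subseteq> convex hull {a, b}"
        by (simp add: seg)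
      then have "{x} \<subseteq> {a, b}"
        using convex_hull_subset_affine_independent[OF S(1), of "{x}" "{a, b}"] that(1) ab(1,2)
        by simp
      then show False using that by simp
    qed
    have orth: "orthogonal (y - ?m) (Q - ?m)"
      if "dist a y = s" "dist b y = s" and Q: "Q \<in> convex hull {a, b}" for y Q
    proof -
      obtain t where t: "Q = (1 - t) *\<^sub>R a + t *\<^sub>R b"
        using Q unfolding seg closed_segment_def by blast
      have "Q - ?m = (t - 1 / 2) *\<^sub>R (b - a)"
        by (intro vector_eq_ldot[THEN iffD1])
           (simp add: t midpoint_def inner_add_right inner_diff_right field_simps)
      moreover have "(y - ?m) \<bullet> (b - a) = 0"
        using that by (intro altitude_orthogonal) simp
      ultimately show ?thesis by (simp add: orthogonal_def)
    qed
    show "\<exists>F G P X Y. F facet_of convex hull S \<and> G facet_of convex hull S \<and> F \<noteq> G \<and>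
        convex hull {a, b} \<subseteq> F \<and> convex hull {a, b} \<subseteq> G \<and>
        P \<in> rel_interior (convex hull {a, b}) \<and> X \<in> F - {P} \<and> Y \<in> G - {P} \<and>
        (\<forall>Q\<in>convex hull {a, b}. orthogonal (X - P) (Q - P)) \<and>
        (\<forall>Q\<in>convex hull {a, b}. orthogonal (Y - P) (Q - P)) \<and>
        arccos (1 / 3) = vector_angle (X - P) (Y - P)"
    proof (intro exI conjI ballI)
      show "c \<in> convex hull {a, b, c} - {?m}" "d \<in> convex hull {a, b, d} - {?m}"
        using noteq inS ne by (simp_all add: hull_inc)
      show "convex hull {a, b} \<subseteq> convex hull {a, b, c}" "convex hull {a, b} \<subseteq> convex hull {a, b, d}"
        by (intro hull_mono; simp)+
    qed (use fac neq m orth dists angle in simp_all)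
  next
    fix \<theta>
    assume "\<exists>F G P X Y. F facet_of convex hull S \<and> G facet_of convex hull S \<and> F \<noteq> G \<and>
        convex hull {a, b} \<subseteq> F \<and> convex hull {a, b} \<subseteq> G \<and>
        P \<in> rel_interior (convex hull {a, b}) \<and> X \<in> F - {P} \<and> Y \<in> G - {P} \<and>
        (\<forall>Q\<in>convex hull {a, b}. orthogonal (X - P) (Q - P)) \<and>
        (\<forall>Q\<in>convex hull {a, b}. orthogonal (Y - P) (Q - P)) \<and>
        \<theta> = vector_angle (X - P) (Y - P)"
    then obtain F G P X Y where FG: "F facet_of convex hull S" "G facet_of convex hull S" "F \<noteq> G"
        "convex hull {a, b} \<subseteq> F" "convex hull {a, b} \<subseteq> G"
      and P: "P \<in> rel_interior (convex hull {a, b})"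
      and XY: "X \<in> F" "X \<noteq> P" "Y \<in> G" "Y \<noteq> P"
      and oX: "\<And>Q. Q \<in> convex hull {a, b} \<Longrightarrow> orthogonal (X - P) (Q - P)"
      and oY: "\<And>Q. Q \<in> convex hull {a, b} \<Longrightarrow> orthogonal (Y - P) (Q - P)"
      and \<theta>: "\<theta> = vector_angle (X - P) (Y - P)"
      by blast
    have P': "P \<in> closed_segment a b"
      using P rel_interior_subset seg by blast
    have alt: "\<exists>l>0. Z - P = l *\<^sub>R (z - midpoint a b)"
      if "Z \<in> convex hull {a, b, z}" "Z \<noteq> P" "dist a z = s" "dist b z = s"
        "\<And>Q. Q \<in> convex hull {a, b} \<Longrightarrow> orthogonal (Z - P) (Q - P)" for Z z
      using that by (intro triangle_altitude_direction[OF _ ab(3) _ _ P']) (auto simp: hull_inc)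
    consider "F = convex hull {a, b, c}" "G = convex hull {a, b, d}"
      | "F = convex hull {a, b, d}" "G = convex hull {a, b, c}"
      using facets FG by metis
    then show "\<theta> = arccos (1 / 3)"
    proof cases
      case 1
      then obtain l m where "l > 0" "X - P = l *\<^sub>R (c - midpoint a b)"
        "m > 0" "Y - P = m *\<^sub>R (d - midpoint a b)"
        using alt[of X c] alt[of Y d] XY oX oY dists by blast
      then show ?thesis by (simp add: \<theta> vector_angle_scaleR angle)
    next
      case 2
      then obtain l m where "l > 0" "X - P = l *\<^sub>R (d - midpoint a b)"
        "m > 0" "Y - P = m *\<^sub>R (c - midpoint a b)"
        using alt[of X d] alt[of Y c] XY oX oY dists by blast
      then show ?thesis by (simp add: \<theta> vector_angle_scaleR vector_angle_commute angle)
    qed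
  qed
qed

section \<open>Density of the orbits\<close>

theorem corollary3p6:
  fixes T :: "(real^3) set"
    and axis :: "(real^3) set \<Rightarrow> dline"
    and r :: "(real^3) set \<Rightarrow> real^3 \<Rightarrow> real^3"
    and P :: "real^3"
  assumes "regular_tetrahedron T"
    and "\<And>E. E edge_of T \<Longrightarrow> E \<subseteq> points_of (axis E)"
    and "\<And>E. E edge_of T \<Longrightarrow> is_rotation_about (axis E) (r E)"
    and "\<And>E. E edge_of T \<Longrightarrow> Size (axis E) (r E) = pi - dihedral_angle T E"
  shows "closure {f P | f. f \<in> peripatetic {E. E edge_of T} axis r} = UNIV"
proof -
  obtain S where S: "\<not> affine_dependent S" "card S = 4" and T: "T = convex hull S"
    using assms(1) unfolding regular_tetrahedron_def simplex_def by auto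
  obtain s where s: "\<And>x y. \<lbrakk>x \<in> S; y \<in> S; x \<noteq> y\<rbrakk> \<Longrightarrow> dist x y = s"
    using assms(1) unfolding regular_tetrahedron_def T
    by (auto simp: extreme_point_of_convex_hull_affine_independent[OF S(1)])
  have dir: "dir (axis E) \<noteq> 0" if "E edge_of T" for E
  proof
    assume "dir (axis E) = 0"
    then have "E \<subseteq> {base (axis E)}"
      using assms(2)[OF that] by (auto simp: points_of_def)
    then have "aff_dim E \<le> 0"
      using aff_dim_subset[of E "{base (axis E)}"] by simp
    then show False
      using that by (simp add: edge_of_def)
  qed
  define \<phi> where "\<phi> E = Rad (axis E) (r E)" for E
  have r: "r E = rotation (axis E) (\<phi> E)" if "E edge_of T" for E
    using assms(3)[OF that] Rad_rotation[OF dir[OF that]]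
    by (auto simp: is_rotation_about_def \<phi>_def)
  let ?C = "closure {f P | f. f \<in> peripatetic {E. E edge_of T} axis r}"
  have "\<exists>L. {a, b} \<subseteq> points_of L \<and> (\<forall>t. \<forall>x\<in>?C. rotation L t x \<in> ?C)"
    if ab: "a \<in> S" "b \<in> S" "a \<noteq> b" for a b
  proof -
    define E where "E = convex hull {a, b}"
    have E: "E edge_of T"
      using ab by (auto simp: edge_of_def E_def T face_of_convex_hull_affine_independent[OF S(1)]
          aff_dim_convex_hull aff_dim_2 intro!: exI[of _ "{a, b}"])
    have "dihedral_angle T E = arccos (1 / 3)"
      unfolding E_def T by (rule dihedral_angle_regular_simplex[OF S s ab])
    then have "\<bar>\<phi> E\<bar> = pi - arccos (1 / 3)"
      using assms(4)[OF E] by (simp add: Size_def \<phi>_def)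
    then have "cos (\<phi> E) = - 1 / 3"
      using cos_abs_real[of "\<phi> E"] by (simp add: cos_arccos)
    then have irr: "\<phi> E / (2 * pi) \<notin> \<rat>"
      by (rule irrational_angle_of_cos)
    have "{a, b} \<subseteq> points_of (axis E)"
      using assms(2)[OF E] hull_subset[of "{a, b}" convex] by (auto simp: E_def)
    moreover have "rotation (axis E) t x \<in> ?C" if "x \<in> ?C" for t x
      using orbit_closure_rotation_invariant[of "{E. E edge_of T}" axis r \<phi> E, OF _ _ _ irr that]
        dir r E by auto
    ultimately show ?thesis by blast
  qed
  moreover have "?C \<noteq> {}"
    using peripatetic.peripatetic_id[of "{E. E edge_of T}" axis r] by auto
  ultimately show ?thesis
    by (intro rotation_invariant_closed_set_eq_UNIV[OF S]) auto
qed

end
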